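(* Let $f=a_0+a_1x+\cdots+a_nx^n\in\mathbb{Z}[x]$ be such that $a_0=\pm p_1^{k_1}\cdots p_r^{k_r}$ with $r\geq 2$, where $p_1,\ldots,p_r$ are distinct primes and $k_1,\ldots,k_r$ are positive integers. Suppose that for each $i=1,\ldots,r$ there exists a positive integer $j_i\leq n$ such that: (i) $v_{p_i}(a_{j_i})=0$; (ii) $\frac{k_i}{j_i}<\frac{v_{p_i}(a_t)}{j_i-t}$ for each $t=1,\ldots,j_i-1$; (iii) $\gcd(k_i,j_i)=1$. If each zero $\theta\in\mathbb{C}$ of $f$ satisfies $|\theta|>1$, then $f$ is a product of at most $r$ irreducible factors in $\mathbb{Z}[x]$.
   Context: For a prime $p$, $v_p$ denotes the $p$-adic valuation: $v_p(0)=\infty$ and for a nonzero integer $a$, $v_p(a)$ is the largest nonnegative integer $e$ with $p^e\mid a$. *)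

theory Defs
  imports
    Complex_Main
    "HOL-Library.Extended_Real"
    "HOL-Library.Multiset"
    "HOL-Computational_Algebra.Computational_Algebra"
begin

text \<open>The library's \<open>multiplicity\<close> yields \<open>0\<close> at \<open>0\<close>, whereas the
  \<open>p\<close>-adic valuation of \<open>0\<close> is infinite.\<close>

definition padic_val :: "nat \<Rightarrow> int \<Rightarrow> enat" where
  "padic_val p a = (if a = 0 then \<infinity> else enat (multiplicity (int p) a))"

end

theory Submission
  imports Defs
begin

text \<open>Fix \<open>p = p\<^sub>i\<close>, \<open>k = k\<^sub>i\<close>, \<open>j = j\<^sub>i\<close> and give a nonzero coefficient \<open>a\<close> of \<open>x\<^sup>t\<close> the weight
  \<open>j v\<^sub>p(a) + k t\<close>. Conditions (i) and (ii) say that all weights of \<open>f\<close> are at least \<open>k j\<close>, the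
  weight of its constant term. Minimal weights are additive (Gauss), so if \<open>f = g h\<close>, then the
  minimal weights of \<open>g\<close> and \<open>h\<close> add up to at least \<open>k j\<close>. As \<open>p\<close> does not divide \<open>a\<^sub>j\<close>, it divides
  neither the coefficient of \<open>x\<^sup>i\<close> in \<open>g\<close> nor that of \<open>x\<^bsup>j-i\<^esup>\<close> in \<open>h\<close> for some \<open>i\<close>; comparing the
  weights of these with those of the constant terms gives \<open>j v\<^sub>p(g(0)) = k i\<close>, so \<open>j\<close> divides \<open>i\<close>
  and \<open>p\<close> divides only one of \<open>g(0)\<close>, \<open>h(0)\<close>. On the other hand, every irreducible factor \<open>g\<close> has
  \<open>\<bar>g(0)\<bar> > 1\<close> because its zeros lie outside the unit disc, so some \<open>p\<^sub>i\<close> divides \<open>g(0)\<close>. Hence the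
  factors inject into the set of primes.\<close>

section \<open>Counting elements of a multiset by private indices\<close>

lemma size_le_card_if_private_index:
  assumes "finite I"
    and "\<forall>g\<in>#F. \<exists>i\<in>I. R g i"
    and "\<forall>i\<in>I. size (filter_mset (\<lambda>g. R g i) F) \<le> 1"
  shows "size F \<le> card I"
  using assms
proof (induction F arbitrary: I)
  case empty
  then show ?case by simp
next
  case (add g F)
  obtain i where i: "i \<in> I" "R g i" using add.prems(2) by auto
  have none: "filter_mset (\<lambda>g. R g i) F = {#}"
    using add.prems(3) i by fastforce
  \<comment> \<open>The index \<open>i\<close> of \<open>g\<close> serves no element of
    \<open>F\<close>, so each of those still finds an index once \<open>i\<close> is
    removed.\<close>
  have "size F \<le> card (I - {i})"
  proof (rule add.IH)
    show "finite (I - {i})" using add.prems(1) by simp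
    show "\<forall>g\<in>#F. \<exists>i'\<in>I - {i}. R g i'"
    proof
      fix h assume h: "h \<in># F"
      then obtain i' where "i' \<in> I" "R h i'" using add.prems(2) by auto
      moreover have "h \<notin># filter_mset (\<lambda>g. R g i) F" unfolding none by simp
      then have "\<not> R h i" using h by simp
      ultimately show "\<exists>i'\<in>I - {i}. R h i'" by auto
    qed
    show "\<forall>i'\<in>I - {i}. size (filter_mset (\<lambda>g. R g i') F) \<le> 1"
    proof
      fix i' assume "i' \<in> I - {i}"
      then have "size (filter_mset (\<lambda>g. R g i') (add_mset g F)) \<le> 1"
        using add.prems(3) by blast
      moreover have "size (filter_mset (\<lambda>g. R g i') F)
          \<le> size (filter_mset (\<lambda>g. R g i') (add_mset g F))" by simp
      ultimately show "size (filter_mset (\<lambda>g. R g i') F) \<le> 1" by linarith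
    qed
  qed
  then show ?case using i(1) add.prems(1) by (simp add: card_Diff_singleton)
    (metis Suc_leI Suc_pred card_gt_0_iff empty_iff le_imp_less_Suc)
qed

section \<open>Weights of coefficients and a Gauss argument\<close>

lemma poly_minimal_weight:
  fixes g :: "int poly" and \<omega> :: "int \<Rightarrow> nat \<Rightarrow> nat"
  assumes "g \<noteq> 0"
  obtains s where "coeff g s \<noteq> 0"
    and "\<And>t. coeff g t \<noteq> 0 \<Longrightarrow> \<omega> (coeff g s) s \<le> \<omega> (coeff g t) t"
    and "\<And>t. coeff g t \<noteq> 0 \<Longrightarrow> t < s \<Longrightarrow> \<omega> (coeff g s) s < \<omega> (coeff g t) t"
proof -
  define P where "P w t \<longleftrightarrow> coeff g t \<noteq> 0 \<and> \<omega> (coeff g t) t = w" for w t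
  define w where "w = (LEAST w. \<exists>t. P w t)"
  \<comment> \<open>Among the indices of minimal weight the least is chosen; this makes the
    inequality strict below \<open>s\<close>.\<close>
  define s where "s = (LEAST s. P w s)"
  have "\<exists>w t. P w t" using assms by (auto simp: P_def intro: exI[of _ "degree g"])
  then have "\<exists>t. P w t" unfolding w_def by (rule LeastI_ex)
  then have s: "P w s" unfolding s_def by (rule LeastI_ex)
  have le: "w \<le> \<omega> (coeff g t) t" if "coeff g t \<noteq> 0" for t
    unfolding w_def by (rule Least_le) (use that in \<open>auto simp: P_def\<close>)
  have "\<not> P w t" if "t < s" for t using that not_less_Least unfolding s_def by blast
  then show ?thesis using that[of s] s le by (force simp: P_def le_less)
qed

text \<open>As in Gauss's lemma, let \<open>s\<close> and \<open>s'\<close> be the first indices of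
  minimal weight in \<open>g\<close> and \<open>h\<close>. In the coefficient of
  \<open>g * h\<close> at \<open>s + s'\<close>, the product of these two coefficients has strictly
  smaller valuation than every other nonzero summand, so it cannot cancel.\<close>

lemma minimal_weights_add:
  fixes g h :: "int poly" and q :: int
  assumes q: "prime q" and "g \<noteq> 0" "h \<noteq> 0"
    and low: "\<And>n. coeff (g * h) n \<noteq> 0 \<Longrightarrow> W \<le> j * multiplicity q (coeff (g * h) n) + k * n"
  obtains u v where "W \<le> u + v"
    and "\<And>t. coeff g t \<noteq> 0 \<Longrightarrow> u \<le> j * multiplicity q (coeff g t) + k * t"
    and "\<And>t. coeff h t \<noteq> 0 \<Longrightarrow> v \<le> j * multiplicity q (coeff h t) + k * t"
proof -
  define \<omega> where "\<omega> a t = j * multiplicity q a + k * t" for a t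
  have qe: "prime_elem q" using q by (rule prime_imp_prime_elem)
  have nu: "\<not> is_unit q" using q not_prime_unit by blast
  obtain s where s: "coeff g s \<noteq> 0"
    "\<And>t. coeff g t \<noteq> 0 \<Longrightarrow> \<omega> (coeff g s) s \<le> \<omega> (coeff g t) t"
    "\<And>t. coeff g t \<noteq> 0 \<Longrightarrow> t < s \<Longrightarrow> \<omega> (coeff g s) s < \<omega> (coeff g t) t"
    using poly_minimal_weight[of g \<omega>] assms(2) by metis
  obtain s' where s': "coeff h s' \<noteq> 0"
    "\<And>t. coeff h t \<noteq> 0 \<Longrightarrow> \<omega> (coeff h s') s' \<le> \<omega> (coeff h t) t"
    "\<And>t. coeff h t \<noteq> 0 \<Longrightarrow> t < s' \<Longrightarrow> \<omega> (coeff h s') s' < \<omega> (coeff h t) t"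
    using poly_minimal_weight[of h \<omega>] assms(3) by metis
  define A where "A = multiplicity q (coeff g s * coeff h s')"
  have A: "A = multiplicity q (coeff g s) + multiplicity q (coeff h s')"
    unfolding A_def using qe s(1) s'(1) by (rule prime_elem_multiplicity_mult_distrib)
  have others: "q ^ Suc A dvd coeff g i * coeff h (s + s' - i)"
    if i: "i \<le> s + s'" "i \<noteq> s" for i
  proof (cases "coeff g i = 0 \<or> coeff h (s + s' - i) = 0")
    case True
    then show ?thesis by auto
  next
    case False
    then have gh: "coeff g i \<noteq> 0" "coeff h (s + s' - i) \<noteq> 0" by auto
    let ?B = "multiplicity q (coeff g i) + multiplicity q (coeff h (s + s' - i))"
    \<comment> \<open>Since \<open>i\<close> differs from \<open>s\<close>, one of the two indices
      lies below its counterpart \<open>s\<close> or \<open>s'\<close>, where the inequality is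
      strict.\<close>
    have "\<omega> (coeff g s) s + \<omega> (coeff h s') s' < \<omega> (coeff g i) i + \<omega> (coeff h (s + s' - i)) (s + s' - i)"
    proof (cases "i < s")
      case True
      then show ?thesis using s(3)[OF gh(1)] s'(2)[OF gh(2)] by linarith
    next
      case False
      then have "s + s' - i < s'" using i by linarith
      then show ?thesis using s(2)[OF gh(1)] s'(3)[OF gh(2)] by linarith
    qed
    \<comment> \<open>The index parts of the weights agree, so the strict inequality passes to the
      valuations.\<close>
    moreover have "k * i + k * (s + s' - i) = k * s + k * s'"
      using i(1) by (metis add_mult_distrib2 le_add_diff_inverse)
    ultimately have "j * A < j * ?B" unfolding \<omega>_def A add_mult_distrib2 by linarith
    then have "Suc A \<le> ?B" by auto
    moreover have "multiplicity q (coeff g i * coeff h (s + s' - i)) = ?B"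
      using qe gh by (rule prime_elem_multiplicity_mult_distrib)
    ultimately show ?thesis using multiplicity_dvd' by metis
  qed
  have split: "coeff (g * h) (s + s') = coeff g s * coeff h s'
      + (\<Sum>i\<in>{..s + s'} - {s}. coeff g i * coeff h (s + s' - i))"
    unfolding coeff_mult by (subst sum.remove[of _ s]) auto
  have rest: "q ^ Suc A dvd (\<Sum>i\<in>{..s + s'} - {s}. coeff g i * coeff h (s + s' - i))"
    by (rule dvd_sum) (use others in auto)
  have "\<not> q ^ Suc A dvd coeff g s * coeff h s'"
    using s(1) s'(1) nu A_def by (simp add: power_dvd_iff_le_multiplicity del: power_Suc)
  then have ndvd: "\<not> q ^ Suc A dvd coeff (g * h) (s + s')"
    using rest split by (simp add: dvd_add_left_iff)
  then have nz: "coeff (g * h) (s + s') \<noteq> 0" by (metis dvd_0_right)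
  then have "multiplicity q (coeff (g * h) (s + s')) \<le> A"
    using ndvd nu by (simp add: power_dvd_iff_le_multiplicity del: power_Suc)
  then have "j * multiplicity q (coeff (g * h) (s + s')) \<le> j * A" by simp
  then have "W \<le> \<omega> (coeff g s) s + \<omega> (coeff h s') s'"
    using low[OF nz] unfolding \<omega>_def A add_mult_distrib2 by linarith
  then show ?thesis using that s(2) s'(2) unfolding \<omega>_def by blast
qed

lemma prime_dvd_one_constant_term:
  fixes g h :: "int poly" and q :: int
  assumes q: "prime q" and "0 < j" and cop: "coprime k j"
    and f0: "coeff (g * h) 0 \<noteq> 0" "multiplicity q (coeff (g * h) 0) = k"
    and fj: "\<not> q dvd coeff (g * h) j"
    and low: "\<And>t. 0 < t \<Longrightarrow> t < j \<Longrightarrow> coeff (g * h) t \<noteq> 0 \<Longrightarrow>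
      k * (j - t) < j * multiplicity q (coeff (g * h) t)"
  shows "\<not> (q dvd coeff g 0 \<and> q dvd coeff h 0)"
proof
  assume dvd: "q dvd coeff g 0 \<and> q dvd coeff h 0"
  have qe: "prime_elem q" using q by (rule prime_imp_prime_elem)
  have nz: "coeff g 0 \<noteq> 0" "coeff h 0 \<noteq> 0" using f0(1) by (auto simp: coeff_mult)
  have gh: "g \<noteq> 0" "h \<noteq> 0" using nz by auto
  \<comment> \<open>The constant term has weight exactly \<open>k * j\<close>; strictly between 0
    and \<open>j\<close> the bound is \<open>low\<close>; from \<open>j\<close> on the index part
    alone suffices.\<close>
  have "k * j \<le> j * multiplicity q (coeff (g * h) n) + k * n" if "coeff (g * h) n \<noteq> 0" for n
  proof -
    consider "n = 0" | "0 < n" "n < j" | "j \<le> n" by linarith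
    then show ?thesis
    proof cases
      case 1
      then show ?thesis using f0(2) by simp
    next
      case 2
      then have "k * (j - n) + k * n = k * j" by (metis add_mult_distrib2 le_add_diff_inverse2 less_imp_le)
      then show ?thesis using low[OF 2 that] by linarith
    next
      case 3
      then have "k * j \<le> k * n" by simp
      then show ?thesis by linarith
    qed
  qed
  then obtain u v where uv: "k * j \<le> u + v"
    "\<And>t. coeff g t \<noteq> 0 \<Longrightarrow> u \<le> j * multiplicity q (coeff g t) + k * t"
    "\<And>t. coeff h t \<noteq> 0 \<Longrightarrow> v \<le> j * multiplicity q (coeff h t) + k * t"
    using minimal_weights_add[OF q gh, of "k * j" j k] by metis
  obtain i where i: "i \<le> j" "\<not> q dvd coeff g i * coeff h (j - i)"
    using fj unfolding coeff_mult by (meson atMost_iff dvd_sum)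
  then have ndvd: "\<not> q dvd coeff g i" "\<not> q dvd coeff h (j - i)" by auto
  have "u \<le> k * i" using uv(2)[of i] ndvd(1)
    by (cases "coeff g i = 0") (auto simp: not_dvd_imp_multiplicity_0)
  moreover have "v \<le> k * (j - i)" using uv(3)[of "j - i"] ndvd(2)
    by (cases "coeff h (j - i) = 0") (auto simp: not_dvd_imp_multiplicity_0)
  moreover have "k * i + k * (j - i) = k * j" using i(1) by (metis add_mult_distrib2 le_add_diff_inverse)
  moreover have "u \<le> j * multiplicity q (coeff g 0)" using uv(2)[of 0] nz by simp
  moreover have "v \<le> j * multiplicity q (coeff h 0)" using uv(3)[of 0] nz by simp
  moreover have mult0: "multiplicity q (coeff g 0) + multiplicity q (coeff h 0) = k"
    using prime_elem_multiplicity_mult_distrib[OF qe nz] f0(2) by (simp add: coeff_mult)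
  then have "j * multiplicity q (coeff g 0) + j * multiplicity q (coeff h 0) = k * j"
    by (metis add_mult_distrib2 mult.commute)
  \<comment> \<open>The upper bounds \<open>k * i\<close> for \<open>u\<close> and
    \<open>k * (j - i)\<close> for \<open>v\<close> add up to \<open>k * j\<close>, and so do the
    bounds from the constant terms. As \<open>u + v\<close> is at least \<open>k * j\<close>, all of
    them are equalities.\<close>
  ultimately have eq: "j * multiplicity q (coeff g 0) = k * i" using uv(1) by linarith
  then have "j dvd i" using cop by (metis coprime_commute coprime_dvd_mult_right_iff dvd_triv_left)
  then have "i = 0 \<or> i = j" using i(1) by (auto dest: dvd_imp_le)
  then show False
  proof
    assume "i = 0"
    then show False using ndvd(1) dvd by simp
  next
    assume "i = j"
    then show False using ndvd(2) dvd by simp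
  qed
qed

section \<open>Zeros outside the unit disc\<close>

lemma norm_lead_coeff_less_norm_constant:
  fixes P :: "complex poly"
  assumes "degree P > 0" and "\<And>z. poly P z = 0 \<Longrightarrow> cmod z > 1"
  shows "cmod (lead_coeff P) < cmod (coeff P 0)"
  using assms
proof (induction "degree P" arbitrary: P)
  case 0
  then show ?case by simp
next
  case (Suc n)
  have "\<not> constant (poly P)" using Suc.prems(1) by (simp add: constant_degree)
  then obtain a where a: "poly P a = 0" using fundamental_theorem_of_algebra by blast
  \<comment> \<open>Splitting off a zero \<open>a\<close> keeps the leading coefficient and divides
    the constant term by \<open>- a\<close>. The cofactor may be constant, so only a weak inequality
    is asked of it; strictness comes from \<open>cmod a > 1\<close>.\<close>
  then obtain H where H: "P = [:- a, 1:] * H" by (auto simp: poly_eq_0_iff_dvd dvd_def)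
  have "P \<noteq> 0" using Suc.prems(1) by auto
  then have H0: "H \<noteq> 0" using H by auto
  have deg: "degree P = Suc (degree H)" unfolding H using H0 by (subst degree_mult_eq) auto
  have lc: "lead_coeff P = lead_coeff H" unfolding H by (subst lead_coeff_mult) simp
  have c0: "coeff P 0 = - a * coeff H 0" unfolding H by (simp add: coeff_mult)
  have a1: "1 < cmod a" using Suc.prems(2) a by blast
  have le: "cmod (lead_coeff H) \<le> cmod (coeff H 0)"
  proof (cases "degree H = 0")
    case True
    then show ?thesis by simp
  next
    case False
    have "cmod (lead_coeff H) < cmod (coeff H 0)"
      by (rule Suc.hyps(1)) (use False deg Suc.hyps(2) Suc.prems(2) H in auto)
    then show ?thesis by simp
  qed
  have "0 < cmod (lead_coeff H)" using H0 by simp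
  then have "0 < cmod (coeff H 0)" using le by linarith
  then have "cmod (coeff H 0) < cmod a * cmod (coeff H 0)" using a1 by simp
  then show ?case using le unfolding lc c0 by (simp add: norm_mult)
qed

text \<open>A constant polynomial with unit constant term is a unit. For positive degree, the zeros
  of \<open>g\<close> are zeros of \<open>f\<close>, so a unit constant term would force a nonzero
  integer leading coefficient of absolute value below 1.\<close>

lemma nonunit_factor_constant_term:
  fixes f g :: "int poly"
  assumes "g dvd f" "f \<noteq> 0" "\<not> is_unit g"
    and roots: "\<forall>z::complex. poly (map_poly of_int f) z = 0 \<longrightarrow> cmod z > 1"
  shows "\<not> is_unit (coeff g 0)"
proof
  assume unit: "is_unit (coeff g 0)"
  obtain h where h: "f = g * h" using assms(1) by auto
  have "degree g > 0"
  proof (rule ccontr)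
    assume "\<not> degree g > 0"
    then obtain c where "g = [:c:]" by (metis degree_eq_zeroE gr0I)
    then show False using assms(3) unit by (simp add: is_unit_const_poly_iff)
  qed
  let ?G = "map_poly of_int g :: complex poly"
  have fgh: "(map_poly of_int f :: complex poly) = ?G * map_poly of_int h"
    unfolding h by (intro poly_eqI) (simp add: coeff_map_poly coeff_mult)
  have deg: "degree ?G = degree g" by (rule degree_map_poly) auto
  have "cmod (lead_coeff ?G) < cmod (coeff ?G 0)"
    by (rule norm_lead_coeff_less_norm_constant)
      (use deg \<open>degree g > 0\<close> roots fgh in auto)
  then have "\<bar>lead_coeff g\<bar> < \<bar>coeff g 0\<bar>"
    by (simp add: deg coeff_map_poly)
  moreover have "lead_coeff g \<noteq> 0" using \<open>degree g > 0\<close> by auto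
  ultimately show False using unit by (simp add: zdvd1_eq)
qed

section \<open>Valuations of coefficients and factorization into irreducibles\<close>

lemma slope_inequality:
  assumes "0 < t" "t < j" "a \<noteq> 0"
    and "ereal (real k / real j) < ereal_of_enat (padic_val p a) / ereal (real j - real t)"
  shows "k * (j - t) < j * multiplicity (int p) a"
proof -
  have "real k / real j < real (multiplicity (int p) a) / (real j - real t)"
    using assms by (simp add: padic_val_def)
  then have "real k * (real j - real t) < real j * real (multiplicity (int p) a)"
    using assms(1,2) by (simp add: field_simps)
  then have "real (k * (j - t)) < real (j * multiplicity (int p) a)"
    using assms(2) by (simp add: of_nat_diff)
  then show ?thesis by (simp only: of_nat_less_iff)
qed

lemma multiplicity_prod_distinct_primes:
  fixes p k :: "nat \<Rightarrow> nat"
  assumes "finite I" "\<forall>i\<in>I. prime (p i)" "inj_on p I" "i \<in> I"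
  shows "multiplicity (int (p i)) (\<Prod>i\<in>I. int (p i) ^ k i) = k i"
proof -
  have pe: "prime_elem (int (p i))" using assms by simp
  have "multiplicity (int (p i)) (\<Prod>i\<in>I. int (p i) ^ k i)
      = (\<Sum>i'\<in>I. multiplicity (int (p i)) (int (p i') ^ k i'))"
    using assms pe by (intro prime_elem_multiplicity_prod_distrib) (auto dest: prime_gt_0_nat)
  also have "\<dots> = (\<Sum>i'\<in>I. if i' = i then k i else 0)"
  proof (rule sum.cong[OF refl])
    fix i' assume i': "i' \<in> I"
    show "multiplicity (int (p i)) (int (p i') ^ k i') = (if i' = i then k i else 0)"
    proof (cases "i' = i")
      case True
      then show ?thesis using pe by (simp add: multiplicity_same_power prime_elem_not_unit)
    next
      case False
      then have "p i' \<noteq> p i" using assms i' by (meson inj_on_def)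
      then have "multiplicity (int (p i)) (int (p i') ^ k i') = 0"
        using assms i' by (intro multiplicity_distinct_prime_power) auto
      then show ?thesis using False by simp
    qed
  qed
  also have "\<dots> = k i" using assms by simp
  finally show ?thesis .
qed

text \<open>Prime factorization yields \<open>f\<close> only up to a unit. As \<open>f\<close> is
  not a unit, there is at least one factor, and it can absorb that unit.\<close>

lemma nonunit_eq_prod_irreducible:
  fixes f :: "int poly"
  assumes "f \<noteq> 0" "\<not> is_unit f"
  obtains F where "\<forall>g\<in>#F. irreducible g" "f = prod_mset F"
proof -
  obtain F where F: "\<And>g. g \<in># F \<Longrightarrow> prime_elem g" "normalize (prod_mset F) = normalize f"
    using prime_factorization_exists[OF assms(1)] by (metis prime_def)
  then obtain u where u: "is_unit u" "f = u * prod_mset F"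
    by (metis associatedE2)
  have "F \<noteq> {#}" using u assms(2) by auto
  then obtain g F' where gF: "F = add_mset g F'" by (metis multiset_cases)
  have irr: "irreducible h" if "h \<in># F" for h using F(1)[OF that] by (rule prime_elem_imp_irreducible)
  have "\<forall>h\<in>#add_mset (u * g) F'. irreducible h"
    using irr u(1) unfolding gF by (auto simp: irreducible_mult_unit_left)
  moreover have "f = prod_mset (add_mset (u * g) F')" using u(2) gF by (simp add: ac_simps)
  ultimately show ?thesis using that by blast
qed

section \<open>Matching the irreducible factors with the primes of the constant term\<close>

theorem theorem6:
  fixes f :: "int poly" and r :: nat and p k :: "nat \<Rightarrow> nat"
  assumes "r \<ge> 2"
    and "\<forall>i\<in>{1..r}. prime (p i)"
    and "inj_on p {1..r}"
    and "\<forall>i\<in>{1..r}. k i > 0"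
    and "coeff f 0 = (\<Prod>i=1..r. int (p i) ^ k i) \<or>
         coeff f 0 = - (\<Prod>i=1..r. int (p i) ^ k i)"
    and "\<forall>i\<in>{1..r}. \<exists>j::nat. 0 < j \<and> j \<le> degree f \<and>
           padic_val (p i) (coeff f j) = 0 \<and>
           (\<forall>t\<in>{1..<j}. ereal (real (k i) / real j)
               < ereal_of_enat (padic_val (p i) (coeff f t)) / ereal (real j - real t)) \<and>
           gcd (k i) j = 1"
    and "\<forall>\<theta>::complex. poly (map_poly of_int f) \<theta> = 0 \<longrightarrow> cmod \<theta> > 1"
  shows "\<exists>F :: int poly multiset. size F \<le> r \<and> (\<forall>g\<in>#F. irreducible g) \<and> f = prod_mset F"
proof -
  let ?N = "\<Prod>i=1..r. int (p i) ^ k i"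
  have N0: "?N \<noteq> 0" using assms(2) by (fastforce dest: prime_gt_0_nat)
  have f00: "coeff f 0 \<noteq> 0" using assms(5) N0 by (metis neg_equal_0_iff_equal)
  then have f0: "f \<noteq> 0" by auto
  have mult: "multiplicity (int (p i)) (coeff f 0) = k i" if "i \<in> {1..r}" for i
    using assms(5) multiplicity_prod_distinct_primes[OF _ assms(2,3) that, of k]
    by auto
  have "1 \<in> {1..r}" using assms(1) by simp
  then have "degree f > 0" using assms(6) by (meson order_less_le_trans)
  then have "\<not> is_unit f" using f0 by (auto simp: is_unit_iff_degree is_unit_poly_iff)
  then obtain F where F: "\<forall>g\<in>#F. irreducible g" "f = prod_mset F"
    using nonunit_eq_prod_irreducible[OF f0] by blast
  have "\<exists>i\<in>{1..r}. int (p i) dvd coeff g 0" if g: "g \<in># F" for g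
  proof -
    have gf: "g dvd f" using F(2) g by (simp add: dvd_prod_mset)
    have "\<not> is_unit g" using F(1) g by (auto simp: irreducible_def)
    then have "\<not> is_unit (coeff g 0)"
      using nonunit_factor_constant_term[OF gf f0 _ assms(7)] by simp
    then have "\<bar>coeff g 0\<bar> \<noteq> 1" by simp
    \<comment> \<open>Any prime divisor of \<open>coeff g 0\<close> divides \<open>coeff f 0\<close>
      and is therefore one of the \<open>p i\<close>.\<close>
    then obtain q where q: "prime q" "q dvd coeff g 0" by (rule prime_factor_int)
    have "coeff g 0 dvd coeff f 0" using gf by (auto simp: coeff_mult elim!: dvdE)
    then have "q dvd ?N" using q(2) assms(5) by (auto intro: dvd_trans)
    then obtain i where i: "i \<in> {1..r}" "q dvd int (p i) ^ k i"
      using q(1) by (auto simp: prime_dvd_prod_iff)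
    then have "q dvd int (p i)" using q(1) prime_dvd_power by blast
    then have "q = int (p i)" using q(1) assms(2) i(1) by (simp add: primes_dvd_imp_eq)
    then show ?thesis using q(2) i(1) by blast
  qed
  moreover have "size (filter_mset (\<lambda>g. int (p i) dvd coeff g 0) F) \<le> 1" if i: "i \<in> {1..r}" for i
  proof (rule ccontr)
    let ?R = "\<lambda>g. int (p i) dvd coeff g 0"
    assume "\<not> size (filter_mset ?R F) \<le> 1"
    \<comment> \<open>Two occurrences \<open>g\<close> and \<open>h\<close> are taken out of the
      multiset; they may be equal as polynomials.\<close>
    then obtain n where n: "size (filter_mset ?R F) = Suc (Suc n)"
      by (cases "size (filter_mset ?R F)"; cases "size (filter_mset ?R F) - 1") auto
    then obtain g D\<^sub>1 where D\<^sub>1: "filter_mset ?R F = add_mset g D\<^sub>1"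
      by (blast dest: size_eq_Suc_imp_eq_union)
    then have "size D\<^sub>1 = Suc n" using n by simp
    then obtain h D where "D\<^sub>1 = add_mset h D" by (blast dest: size_eq_Suc_imp_eq_union)
    then have D: "filter_mset ?R F = add_mset g (add_mset h D)" using D\<^sub>1 by simp
    have "g \<in># filter_mset ?R F" "h \<in># filter_mset ?R F" unfolding D by simp_all
    then have gh: "int (p i) dvd coeff g 0" "int (p i) dvd coeff h 0" by simp_all
    define E where "E = D + filter_mset (\<lambda>g. \<not> ?R g) F"
    have "F = add_mset g (add_mset h E)"
      by (subst multiset_partition[of F ?R]) (simp add: D E_def)
    \<comment> \<open>Everything but \<open>g\<close> forms one cofactor; its constant term inherits
      divisibility by \<open>p i\<close> from that of \<open>h\<close>.\<close>
    then have fgh: "f = g * (h * prod_mset E)" using F(2) by simp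
    obtain j where j: "0 < j" "padic_val (p i) (coeff f j) = 0"
      "\<forall>t\<in>{1..<j}. ereal (real (k i) / real j)
         < ereal_of_enat (padic_val (p i) (coeff f t)) / ereal (real j - real t)"
      "gcd (k i) j = 1"
      using bspec[OF assms(6) i] by (elim exE conjE) (rule that)
    have pr: "prime (int (p i))" using assms(2) i by simp
    have "\<not> is_unit (int (p i))" using pr not_prime_unit by blast
    \<comment> \<open>Valuation 0 also rules out \<open>coeff f j = 0\<close>, since
      \<open>padic_val\<close> is infinite there.\<close>
    then have "\<not> int (p i) dvd coeff f j"
      using j(2) by (auto simp: padic_val_def zero_enat_def multiplicity_eq_zero_iff split: if_splits)
    moreover have "k i * (j - t) < j * multiplicity (int (p i)) (coeff f t)"
      if "0 < t" "t < j" "coeff f t \<noteq> 0" for t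
      using that j(3) by (intro slope_inequality) simp_all
    ultimately have "\<not> (int (p i) dvd coeff g 0 \<and> int (p i) dvd coeff (h * prod_mset E) 0)"
      using prime_dvd_one_constant_term[OF pr j(1), of "k i" g "h * prod_mset E"]
        j(4) mult[OF i] f00 unfolding fgh coprime_iff_gcd_eq_1 by blast
    then show False using gh by (simp add: coeff_mult)
  qed
  ultimately have "size F \<le> card {1..r}"
    by (intro size_le_card_if_private_index[where R = "\<lambda>g i. int (p i) dvd coeff g 0"]) auto
  then show ?thesis using F by auto
qed

end
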